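(* Let $T_L\curvearrowright\mathbb{C}^n$ be a Calabi--Yau representation of a connected complex torus $T_L$. Then the representation is quasi-symmetric if and only if its primary discriminant $\nabla_{pr}\subset T_{L^\vee}$ is a point.
   Context: Setting. $T_L=L\otimes\mathbb{C}^*$ is a connected complex torus with cocharacter lattice $L\neq 0$ of rank $k$, acting linearly on $\mathbb{C}^n$ with weights $\beta_1,\dots,\beta_n\in L^\vee=\mathrm{Hom}(L,\mathbb{Z})$ (listed with multiplicity). The representation is Calabi--Yau if $\sum_i\beta_i=0$. It is quasi-symmetric if for every line $\ell\subset L^\vee_{\mathbb{R}}$ through the origin the sum of the weights $\beta_i$ lying on $\ell$ is zero. Standing assumptions and toric data. The map $Q:(\mathbb{Z}^n)^\vee\to L^\vee$, $e_i^\vee\mapsto\beta_i$, is assumed surjective. Put $M=\ker Q$, $N=M^\vee$. Dualising gives an exact sequence $0\to L\xrightarrow{Q^\vee}\mathbb{Z}^n\xrightarrow{A}N\to 0$. The vectors $\omega_i:=A(e_i)\in N$ are called the rays; they are assumed pairwise distinct, and $A$ also denotes the set $\{\omega_1,\dots,\omega_n\}$. Primary discriminant. Let $T_M=M\otimes\mathbb{C}^*$, so that elements $\omega\in N$ are characters $x^\omega$ of $T_M$. Let $\mathbb{C}^A=\{f=\sum_{\omega\in A}a_\omega x^\omega\}\cong\mathbb{C}^n$ and let $\nabla_A\subset\mathbb{C}^A$ be the Zariski closure of the set of $f$ having a critical point in $T_M$. The set $\nabla_A\cap(\mathbb{C}^* )^n$ is invariant under $T_M\subset(\mathbb{Z}^n)^\vee\otimes\mathbb{C}^*=(\mathbb{C}^*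 )^n$, hence descends to the quotient torus $T_{L^\vee}=L^\vee\otimes\mathbb{C}^*=\mathrm{Hom}(L,\mathbb{C}^* )$. The primary discriminant $\nabla_{pr}\subset T_{L^\vee}$ is $\nabla_A$ viewed in this way. Concretely, $\nabla_{pr}$ is the Zariski closure in $T_{L^\vee}$ of the image of the Horn uniformization, the rational map which, after choosing a basis of $L$ with coordinates $\lambda_1,\dots,\lambda_k$ on $L\otimes\mathbb{C}$ and identifying $T_{L^\vee}\cong(\mathbb{C}^* )^k$, is $$\mathbb{P}^{k-1}\dashrightarrow(\mathbb{C}^* )^k,\qquad[\lambda_1,\dots,\lambda_k]\mapsto\Big(\prod_{j=1}^n(\lambda_1\beta_{j1}+\cdots+\lambda_k\beta_{jk})^{\beta_{ji}}\Big)_{i=1,\dots,k},$$ where $\beta_{j1},\dots,\beta_{jk}$ are the components of $\beta_j$ in the dual basis, and any factor with $\beta_j=0$ is read as $1$. (When no weight is zero, this agrees with the image of $\nabla_A\cap(\mathbb{C}^* )^n$ in $T_{L^\vee}$.) *)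

theory Defs
  imports "HOL-Analysis.Analysis" "HOL-Library.Poly_Mapping"
begin

text \<open>
  After choosing a basis, the cocharacter lattice \<open>L\<close> and its dual are both \<open>int ^ 'k\<close>, with
  \<open>CARD('k)\<close> the (positive) rank, and \<open>L\<close> paired with its dual by the dot product. A linear
  action of the torus on affine space is given by its family of weights
  \<open>\<beta> :: 'n \<Rightarrow> int ^ 'k\<close>, listed with multiplicity.
\<close>

definition calabi_yau :: "('n::finite \<Rightarrow> int ^ 'k::finite) \<Rightarrow> bool" where
  "calabi_yau \<beta> \<longleftrightarrow> (\<Sum>j\<in>UNIV. \<beta> j) = 0"

definition real_weight :: "int ^ 'k::finite \<Rightarrow> real ^ 'k" where
  "real_weight b = (\<chi> i. of_int (b $ i))"

definition quasi_symmetric :: "('n::finite \<Rightarrow> int ^ 'k::finite) \<Rightarrow> bool" where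
  "quasi_symmetric \<beta> \<longleftrightarrow>
     (\<forall>l :: (real ^ 'k) set. subspace l \<and> dim l = 1 \<longrightarrow>
        (\<Sum>j | real_weight (\<beta> j) \<in> l. \<beta> j) = 0)"


definition weight_map :: "('n::finite \<Rightarrow> int ^ 'k::finite) \<Rightarrow> int ^ 'n \<Rightarrow> int ^ 'k" where
  "weight_map \<beta> m = (\<Sum>j\<in>UNIV. (m $ j) *s \<beta> j)"

definition weight_ker :: "('n::finite \<Rightarrow> int ^ 'k::finite) \<Rightarrow> (int ^ 'n) set" where
  "weight_ker \<beta> = {m. weight_map \<beta> m = 0}"

text \<open>
  The map \<open>A\<close> is dual to the inclusion of \<open>M = weight_ker \<beta>\<close>: it sends \<open>v\<close> to the functional
  on \<open>M\<close> given by pairing with \<open>v\<close>. Functionals on \<open>M\<close> are functions restricted to \<open>M\<close>, so that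
  equality of values of \<open>A\<close> is equality in the dual of \<open>M\<close>.
\<close>

definition ray_map :: "('n::finite \<Rightarrow> int ^ 'k::finite) \<Rightarrow> int ^ 'n \<Rightarrow> (int ^ 'n \<Rightarrow> int)" where
  "ray_map \<beta> v = restrict (\<lambda>m. \<Sum>i\<in>UNIV. m $ i * v $ i) (weight_ker \<beta>)"

definition ray :: "('n::finite \<Rightarrow> int ^ 'k::finite) \<Rightarrow> 'n \<Rightarrow> (int ^ 'n \<Rightarrow> int)" where
  "ray \<beta> i = ray_map \<beta> (axis i 1)"


definition torus :: "(complex ^ 'k::finite) set" where
  "torus = {x. \<forall>i. x $ i \<noteq> 0}"

text \<open>
  The regular functions on the torus are the Laurent polynomials, represented by their finitely
  supported families of coefficients.
\<close>

definition laurent_eval :: "(int ^ 'k::finite \<Rightarrow>\<^sub>0 complex) \<Rightarrow> complex ^ 'k \<Rightarrow> complex" where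
  "laurent_eval p x =
     (\<Sum>m\<in>Poly_Mapping.keys p. Poly_Mapping.lookup p m * (\<Prod>i\<in>UNIV. (x $ i) powi (m $ i)))"

definition zariski_closure_torus :: "(complex ^ 'k::finite) set \<Rightarrow> (complex ^ 'k) set" where
  "zariski_closure_torus S =
     {x \<in> torus. \<forall>p. (\<forall>s\<in>S. laurent_eval p s = 0) \<longrightarrow> laurent_eval p x = 0}"


definition weight_form :: "int ^ 'k::finite \<Rightarrow> complex ^ 'k \<Rightarrow> complex" where
  "weight_form b \<mu> = (\<Sum>i\<in>UNIV. \<mu> $ i * of_int (b $ i))"

definition horn_map :: "('n::finite \<Rightarrow> int ^ 'k::finite) \<Rightarrow> complex ^ 'k \<Rightarrow> complex ^ 'k" where
  "horn_map \<beta> \<mu> = (\<chi> i. \<Prod>j | \<beta> j \<noteq> 0. weight_form (\<beta> j) \<mu> powi (\<beta> j $ i))"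

text \<open>
  Homogeneous coordinates of the points of projective space at which no factor of the Horn
  uniformization vanishes. The rational map may extend further, because factors can cancel, but
  this set is a dense open subset of projective space, so the Zariski closure of the image is
  unaffected. By \<open>horn_map_scale\<close> below, the values depend only on the projective point.
\<close>

definition horn_domain :: "('n::finite \<Rightarrow> int ^ 'k::finite) \<Rightarrow> (complex ^ 'k) set" where
  "horn_domain \<beta> = {\<mu>. \<mu> \<noteq> 0 \<and> (\<forall>j. \<beta> j \<noteq> 0 \<longrightarrow> weight_form (\<beta> j) \<mu> \<noteq> 0)}"

definition primary_discriminant :: "('n::finite \<Rightarrow> int ^ 'k::finite) \<Rightarrow> (complex ^ 'k) set" where
  "primary_discriminant \<beta> = zariski_closure_torus (horn_map \<beta> ` horn_domain \<beta>)"

lemma horn_map_in_torus: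
  assumes "\<mu> \<in> horn_domain \<beta>"
  shows "horn_map \<beta> \<mu> \<in> torus"
  using assms by (auto simp: horn_domain_def torus_def horn_map_def)

lemma horn_map_scale:
  fixes \<beta> :: "'n::finite \<Rightarrow> int ^ 'k::finite"
  assumes cy: "calabi_yau \<beta>" and c: "c \<noteq> 0"
  shows "horn_map \<beta> (c *s \<mu>) = horn_map \<beta> \<mu>"
proof -
  have form: "weight_form b (c *s \<mu>) = c * weight_form b \<mu>" for b :: "int ^ 'k"
    by (simp add: weight_form_def sum_distrib_left mult.assoc)
  have pow: "(\<Prod>j\<in>S. c powi e j) = c powi (\<Sum>j\<in>S. e j)" if "finite S"
    for S :: "'n set" and e :: "'n \<Rightarrow> int"
    using that by (induction S rule: finite_induct) (simp_all add: power_int_add c)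
  have "(\<Sum>j | \<beta> j \<noteq> 0. \<beta> j $ i) = 0" for i
  proof -
    have "(\<Sum>j | \<beta> j \<noteq> 0. \<beta> j $ i) = (\<Sum>j\<in>UNIV. \<beta> j $ i)"
      by (rule sum.mono_neutral_left) auto
    also have "\<dots> = (\<Sum>j\<in>UNIV. \<beta> j) $ i" by simp
    also have "\<dots> = 0" using cy by (simp only: calabi_yau_def zero_index)
    finally show ?thesis .
  qed
  then show ?thesis
    by (simp add: horn_map_def form power_int_mult_distrib prod.distrib pow vec_eq_iff)
qed

end

theory Submission
  imports Defs
begin

text \<open>
  Along the points \<open>\<mu>\<^sub>0 + t v\<close>, where \<open>v\<close> spans a line and \<open>\<mu>\<^sub>0\<close> is orthogonal to \<open>v\<close> but to no weight off that
  line, the \<open>i\<close>-th Horn coordinate behaves as \<open>t\<close> tends to \<open>0\<close> like a nonzero constant times \<open>t\<close> to the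
  power of the \<open>i\<close>-th coordinate of the sum of the weights on the line. If the Horn map is constant,
  all these exponents vanish. Conversely, the ratio of the values of a weight form at two points
  depends only on the line spanned by the weight, so the ratio of two values of the Horn map is a
  product of powers whose exponents are the sums of the weights over the lines.
\<close>

section \<open>Integer powers and a limit criterion for exponents\<close>

lemma power_int_sum:
  fixes c :: "'a::field"
  assumes "c \<noteq> 0"
  shows "c powi (\<Sum>j\<in>S. e j) = (\<Prod>j\<in>S. c powi e j)"
  by (induction S rule: infinite_finite_induct) (simp_all add: power_int_add assms)

text \<open>A positive exponent would force the product to tend to \<open>0\<close>, against its
  being the nonzero constant \<open>C\<close>. A negative exponent becomes positive on passing to
  inverses, which is possible because \<open>g\<close> and \<open>C\<close> are nonzero.\<close>

lemma exponent_zero_if_eventually_const: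
  fixes G :: "real \<Rightarrow> real"
  assumes lim: "(G \<longlongrightarrow> g) (at 0)" and g: "g \<noteq> 0" and C: "C \<noteq> 0"
    and ev: "\<forall>\<^sub>F t in at 0. t powi e * G t = C"
  shows "e = 0"
proof -
  have not_pos: "\<not> e > 0"
    if "(G \<longlongrightarrow> g) (at 0)" and "C \<noteq> 0" and "\<forall>\<^sub>F t in at 0. t powi e * G t = C"
    for e and G :: "real \<Rightarrow> real" and g C
  proof
    assume "e > 0"
    then have "((\<lambda>t::real. t powi e) \<longlongrightarrow> 0) (at 0)"
      by (auto simp: power_int_def intro!: tendsto_eq_intros)
    then have "((\<lambda>t. t powi e * G t) \<longlongrightarrow> 0) (at 0)"
      using tendsto_mult[OF _ that(1)] by fastforce
    then have "((\<lambda>_::real. C) \<longlongrightarrow> 0) (at 0)"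
      using that(3) by (rule Lim_transform_eventually)
    then show False
      using that(2) by (simp add: tendsto_const_iff)
  qed
  have "\<forall>\<^sub>F t in at 0. t powi (- e) * inverse (G t) = inverse C"
    using ev by eventually_elim (auto simp: power_int_minus)
  then have "\<not> - e > 0"
    using tendsto_inverse[OF lim g] C by (intro not_pos) auto
  moreover have "\<not> e > 0"
    using lim C ev by (rule not_pos)
  ultimately show ?thesis by simp
qed

section \<open>Avoiding finitely many hyperplanes\<close>

text \<open>A real subspace is not a finite union of proper subspaces. In the induction, moving
  \<open>x\<close> slightly in the direction \<open>y\<close> keeps the finitely many old inner
  products nonzero, while the new one vanishes for at most one value of \<open>t\<close>.\<close>

lemma exists_common_nonorthogonal:
  fixes S :: "'a::real_inner set"
  assumes "finite B" and "subspace S" and "\<And>b. b \<in> B \<Longrightarrow> \<exists>x\<in>S. x \<bullet> b \<noteq> 0"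
  shows "\<exists>x\<in>S. \<forall>b\<in>B. x \<bullet> b \<noteq> 0"
  using assms(1,3)
proof (induction B rule: finite_induct)
  case empty
  then show ?case using subspace_0[OF assms(2)] by blast
next
  case (insert b B)
  obtain x where x: "x \<in> S" "\<And>a. a \<in> B \<Longrightarrow> x \<bullet> a \<noteq> 0"
    using insert by auto
  obtain y where y: "y \<in> S" "y \<bullet> b \<noteq> 0"
    using insert.prems by auto
  have "\<forall>\<^sub>F t in at (0::real). \<forall>a\<in>B. (x + t *\<^sub>R y) \<bullet> a \<noteq> 0"
  proof (intro eventually_ball_finite insert.hyps(1) ballI)
    fix a assume "a \<in> B"
    have "((\<lambda>t. (x + t *\<^sub>R y) \<bullet> a) \<longlongrightarrow> x \<bullet> a) (at 0)"
      by (auto intro!: tendsto_eq_intros)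
    then show "\<forall>\<^sub>F t in at (0::real). (x + t *\<^sub>R y) \<bullet> a \<noteq> 0"
      using x(2)[OF \<open>a \<in> B\<close>] by (rule tendsto_imp_eventually_ne)
  qed
  moreover have "\<forall>\<^sub>F t in at (0::real). t \<noteq> - (x \<bullet> b) / (y \<bullet> b)"
    by (rule eventually_neq_at_within)
  ultimately have "\<forall>\<^sub>F t in at (0::real). \<forall>a\<in>insert b B. (x + t *\<^sub>R y) \<bullet> a \<noteq> 0"
  proof eventually_elim
    case (elim t)
    have "(x + t *\<^sub>R y) \<bullet> b \<noteq> 0"
      using elim(2) y(2) by (auto simp: inner_add_left field_simps add_eq_0_iff)
    then show ?case using elim(1) by simp
  qed
  then obtain t where "\<forall>a\<in>insert b B. (x + t *\<^sub>R y) \<bullet> a \<noteq> 0"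
    using eventually_happens[of _ "at (0::real)"] by auto
  moreover have "x + t *\<^sub>R y \<in> S"
    using x(1) y(1) assms(2) by (simp add: subspace_add subspace_scale)
  ultimately show ?case by blast
qed

text \<open>The witness is the component of \<open>b\<close> orthogonal to \<open>v\<close>, as in
  Gram-Schmidt; its inner product with \<open>b\<close> is its own squared norm.\<close>

lemma exists_orthogonal_nonorthogonal:
  fixes v b :: "'a::real_inner"
  assumes "b \<notin> span {v}"
  shows "\<exists>x. v \<bullet> x = 0 \<and> x \<bullet> b \<noteq> 0"
proof -
  define x where "x = b - (v \<bullet> b / (v \<bullet> v)) *\<^sub>R v"
  have "x \<noteq> 0"
    using assms span_mul[OF span_base[of v "{v}"]] by (metis eq_iff_diff_eq_0 singletonI x_def)
  have vx: "v \<bullet> x = 0"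
    by (cases "v = 0") (simp_all add: x_def inner_diff_right)
  have "x \<bullet> b = x \<bullet> x"
    using vx by (simp add: x_def inner_diff_right inner_commute)
  with vx \<open>x \<noteq> 0\<close> show ?thesis by auto
qed

section \<open>Weight forms and the Horn domain\<close>

lemma real_weight_eq_0_iff [simp]: "real_weight b = 0 \<longleftrightarrow> b = 0"
  by (simp add: real_weight_def vec_eq_iff)

text \<open>At real points the complex forms become real inner products, so points of the Horn
  domain can be found, and limits taken, over the reals.\<close>

lemma weight_form_of_real:
  "weight_form b (\<chi> i. complex_of_real (x $ i)) = of_real (x \<bullet> real_weight b)"
  by (simp add: weight_form_def real_weight_def inner_vec_def)

text \<open>If \<open>c\<close> is nonzero, it cancels in the ratio of the values of a form at two
  points; this is why that ratio depends only on the line of the weight.\<close>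

lemma weight_form_scaled_weight:
  assumes "real_weight b' = c *\<^sub>R real_weight b"
  shows "weight_form b' \<mu> = of_real c * weight_form b \<mu>"
proof -
  have "complex_of_int (b' $ i) = of_real c * of_int (b $ i)" for i
  proof -
    have "real_of_int (b' $ i) = c * real_of_int (b $ i)"
      using assms by (simp add: real_weight_def vec_eq_iff)
    then show ?thesis
      by (metis of_real_mult of_real_of_int_eq)
  qed
  then show ?thesis
    by (simp add: weight_form_def sum_distrib_left mult_ac)
qed

lemma span_singleton_eq_line:
  fixes w :: "'a::euclidean_space"
  assumes "subspace l" "dim l = 1" "w \<in> l" "w \<noteq> 0"
  shows "span {w} = l"
proof -
  have "span {w} = span l"
    using assms by (intro dim_eq_span) auto
  also have "\<dots> = l"
    using assms(1) by (simp add: span_eq_iff)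
  finally show ?thesis .
qed

lemma horn_domain_nonempty: "horn_domain \<beta> \<noteq> {}"
proof -
  let ?B = "insert (axis undefined 1) {real_weight (\<beta> j) |j. \<beta> j \<noteq> 0}"
  have "\<exists>x\<in>UNIV. \<forall>b\<in>?B. x \<bullet> b \<noteq> 0"
  proof (rule exists_common_nonorthogonal)
    fix b assume "b \<in> ?B"
    then have "b \<noteq> 0" by auto
    then show "\<exists>x\<in>UNIV. x \<bullet> b \<noteq> 0" by (intro bexI[of _ b]) auto
  qed auto
  then obtain x where x: "\<And>b. b \<in> ?B \<Longrightarrow> x \<bullet> b \<noteq> 0" by blast
  have "(\<chi> i. complex_of_real (x $ i)) \<in> horn_domain \<beta>"
    using x[of "axis undefined 1"] x
    by (auto simp: horn_domain_def weight_form_of_real vec_eq_iff inner_axis)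
  then show ?thesis by blast
qed

section \<open>Zariski closure in the torus\<close>

lemma laurent_eval_superset:
  assumes "finite K" "Poly_Mapping.keys p \<subseteq> K"
  shows "laurent_eval p x =
    (\<Sum>m\<in>K. Poly_Mapping.lookup p m * (\<Prod>i\<in>UNIV. (x $ i) powi (m $ i)))"
  unfolding laurent_eval_def using assms
  by (intro sum.mono_neutral_left) (auto simp: in_keys_iff)

lemma subset_zariski_closure_torus: "S \<subseteq> torus \<Longrightarrow> S \<subseteq> zariski_closure_torus S"
  by (auto simp: zariski_closure_torus_def)

lemma zariski_closure_torus_singleton:
  assumes "p \<in> torus"
  shows "zariski_closure_torus {p} = {p}"
proof -
  have "x = p" if x: "x \<in> zariski_closure_torus {p}" for x
  proof -
    have "x $ i = p $ i" for i
    proof -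
      define a :: "int ^ 'a" where "a = axis i 1"
      \<comment> \<open>The Laurent polynomial \<open>x_i - p_i\<close>; these cut out the point
        \<open>p\<close>.\<close>
      define q where "q = Poly_Mapping.single a (1::complex) - Poly_Mapping.single 0 (p $ i)"
      have a: "a \<noteq> 0" by (simp add: a_def)
      have keys: "Poly_Mapping.keys q \<subseteq> {a, 0}"
        by (auto simp: q_def in_keys_iff lookup_minus lookup_single when_def split: if_splits)
      have mono: "(\<Prod>k\<in>UNIV. (y $ k) powi (a $ k)) = y $ i" for y :: "complex ^ 'a"
      proof -
        have "(\<Prod>k\<in>UNIV. (y $ k) powi (a $ k)) = (\<Prod>k\<in>UNIV. if k = i then y $ k else 1)"
          by (rule prod.cong) (auto simp: a_def axis_def)
        then show ?thesis by simp
      qed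
      have eval: "laurent_eval q y = y $ i - p $ i" for y
        using a by (subst laurent_eval_superset[OF _ keys])
          (auto simp: mono q_def lookup_minus lookup_single when_def)
      have "laurent_eval q x = 0"
        using x eval[of p] by (simp add: zariski_closure_torus_def)
      then show ?thesis by (simp add: eval)
    qed
    then show ?thesis by (simp add: vec_eq_iff)
  qed
  then show ?thesis
    using subset_zariski_closure_torus[of "{p}"] assms by auto
qed

section \<open>From quasi-symmetry to a constant Horn map\<close>

lemma horn_map_const_if_quasi_symmetric:
  assumes qs: "quasi_symmetric \<beta>" and \<mu>: "\<mu> \<in> horn_domain \<beta>" and \<nu>: "\<nu> \<in> horn_domain \<beta>"
  shows "horn_map \<beta> \<mu> = horn_map \<beta> \<nu>"
proof -
  define J where "J = {j. \<beta> j \<noteq> 0}"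
  define r where "r j = weight_form (\<beta> j) \<mu> / weight_form (\<beta> j) \<nu>" for j
  define L where "L j = span {real_weight (\<beta> j)}" for j
  have r0: "r j \<noteq> 0" if "j \<in> J" for j
    using that \<mu> \<nu> by (auto simp: J_def r_def horn_domain_def)
  have r_cong: "r j = r j'" if "j \<in> J" "j' \<in> J" "L j = L j'" for j j'
  proof -
    have "real_weight (\<beta> j) \<in> L j'"
      using that(3) span_base[of "real_weight (\<beta> j)"] by (auto simp: L_def)
    then obtain c where c: "real_weight (\<beta> j) = c *\<^sub>R real_weight (\<beta> j')"
      by (auto simp: L_def span_singleton)
    then have "c \<noteq> 0" using that(1) by (auto simp: J_def)
    then show ?thesis by (simp add: r_def weight_form_scaled_weight[OF c])
  qed
  \<comment> \<open>All ratios \<open>r j\<close> over one line agree, so their product is a single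
    power, whose exponent vanishes by quasi-symmetry.\<close>
  have fibre: "(\<Prod>j | j \<in> J \<and> L j = L j0. r j powi (\<beta> j $ i)) = 1" if "j0 \<in> J" for j0 i
  proof -
    have L: "subspace (L j0)" "dim (L j0) = 1"
      using that by (auto simp: L_def J_def)
    \<comment> \<open>The right side also counts zero weights, which contribute nothing; every
      nonzero weight on the line spans it.\<close>
    have "(\<Sum>j | j \<in> J \<and> L j = L j0. \<beta> j) = (\<Sum>j | real_weight (\<beta> j) \<in> L j0. \<beta> j)"
    proof (rule sum.mono_neutral_left; (intro ballI)?)
      show "{j. j \<in> J \<and> L j = L j0} \<subseteq> {j. real_weight (\<beta> j) \<in> L j0}"
        using span_base by (fastforce simp: L_def)
      fix j assume "j \<in> {j. real_weight (\<beta> j) \<in> L j0} - {j. j \<in> J \<and> L j = L j0}"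
      then show "\<beta> j = 0"
        using span_singleton_eq_line[OF L, of "real_weight (\<beta> j)"]
        by (auto simp: J_def L_def[of j])
    qed simp
    then have "(\<Sum>j | j \<in> J \<and> L j = L j0. \<beta> j) = 0"
      using qs L by (simp add: quasi_symmetric_def)
    then have sum0: "(\<Sum>j | j \<in> J \<and> L j = L j0. \<beta> j $ i) = 0"
      by (simp only: zero_index flip: sum_component)
    have "(\<Prod>j | j \<in> J \<and> L j = L j0. r j powi (\<beta> j $ i))
        = (\<Prod>j | j \<in> J \<and> L j = L j0. r j0 powi (\<beta> j $ i))"
      by (rule prod.cong) (auto dest: r_cong[OF _ that])
    also have "\<dots> = r j0 powi (\<Sum>j | j \<in> J \<and> L j = L j0. \<beta> j $ i)"
      by (rule power_int_sum[OF r0[OF that], symmetric])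
    finally show ?thesis by (simp only: sum0 power_int_0_right)
  qed
  have "(\<Prod>j\<in>J. r j powi (\<beta> j $ i)) = 1" for i
  proof -
    \<comment> \<open>Group the weights by the line they span.\<close>
    have "(\<Prod>j\<in>J. r j powi (\<beta> j $ i))
        = (\<Prod>l\<in>L ` J. \<Prod>j | j \<in> J \<and> L j = l. r j powi (\<beta> j $ i))"
      by (rule prod.image_gen) (simp add: J_def)
    also have "\<dots> = 1" by (rule prod.neutral) (auto simp: fibre)
    finally show ?thesis .
  qed
  moreover have "(\<Prod>j\<in>J. r j powi (\<beta> j $ i)) = horn_map \<beta> \<mu> $ i / horn_map \<beta> \<nu> $ i" for i
    by (simp add: r_def horn_map_def J_def power_int_divide_distrib prod_dividef)
  ultimately show ?thesis
    by (auto simp: vec_eq_iff)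
qed

section \<open>From a constant Horn map to quasi-symmetry\<close>

lemma quasi_symmetric_if_horn_map_const:
  fixes \<beta> :: "'n::finite \<Rightarrow> int ^ 'k::finite"
  assumes const: "\<And>\<mu>. \<mu> \<in> horn_domain \<beta> \<Longrightarrow> horn_map \<beta> \<mu> = p"
  shows "quasi_symmetric \<beta>"
  unfolding quasi_symmetric_def
proof (intro allI impI)
  fix l :: "(real ^ 'k) set"
  assume "subspace l \<and> dim l = 1"
  then have l: "subspace l" "dim l = 1" by auto
  then have "l \<noteq> {0}" by auto
  then obtain v where v: "v \<in> l" "v \<noteq> 0"
    using subspace_0[OF l(1)] by blast
  have span_v: "span {v} = l"
    using l v by (rule span_singleton_eq_line)
  define w where "w j = real_weight (\<beta> j)" for j
  define J where "J = {j. \<beta> j \<noteq> 0}"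
  define On where "On = {j\<in>J. w j \<in> l}"
  define Off where "Off = {j\<in>J. w j \<notin> l}"
  have "\<exists>x\<in>{x. v \<bullet> x = 0}. \<forall>b\<in>w ` Off. x \<bullet> b \<noteq> 0"
    by (rule exists_common_nonorthogonal)
      (auto simp: Off_def subspace_hyperplane span_v dest!: exists_orthogonal_nonorthogonal
        simp flip: span_v)
  then obtain x where x: "v \<bullet> x = 0" "\<And>j. j \<in> Off \<Longrightarrow> x \<bullet> w j \<noteq> 0" by auto
  define y where "y t = x + t *\<^sub>R v" for t
  have on_multiple: "\<exists>c. w j = c *\<^sub>R v" if "j \<in> On" for j
  proof -
    have "w j \<in> span {v}" using that by (simp add: On_def span_v)
    then show ?thesis by (auto simp: span_singleton)
  qed
  \<comment> \<open>As \<open>x\<close> is orthogonal to the line, the forms of the weights on it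
    vanish to first order at \<open>t = 0\<close>.\<close>
  have on: "y t \<bullet> w j = t * (v \<bullet> w j)" if "j \<in> On" for j t
  proof -
    obtain c where "w j = c *\<^sub>R v"
      using on_multiple[OF \<open>j \<in> On\<close>] by blast
    then show ?thesis using x(1) by (simp add: y_def inner_add_right inner_commute)
  qed
  have von: "v \<bullet> w j \<noteq> 0" if "j \<in> On" for j
  proof -
    obtain c where c: "w j = c *\<^sub>R v"
      using on_multiple[OF \<open>j \<in> On\<close>] by blast
    moreover have "w j \<noteq> 0" using that by (auto simp: On_def J_def w_def)
    ultimately show ?thesis using v(2) by auto
  qed
  have lim: "((\<lambda>t. y t \<bullet> b) \<longlongrightarrow> x \<bullet> b) (at 0)" for b
    by (auto simp: y_def intro!: tendsto_eq_intros)
  have "\<forall>\<^sub>F t in at 0. \<forall>j\<in>Off. y t \<bullet> w j \<noteq> 0"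
    by (intro eventually_ball_finite ballI tendsto_imp_eventually_ne[OF lim] x(2)) auto
  then have ev_dom: "\<forall>\<^sub>F t in at 0. (\<chi> i. complex_of_real (y t $ i)) \<in> horn_domain \<beta>"
    using eventually_neq_at_within[of 0]
  proof eventually_elim
    case (elim t)
    \<comment> \<open>Pairing with \<open>v\<close> gives \<open>t * (v \<bullet> v)\<close>, so the
      point is nonzero even if \<open>x = 0\<close>.\<close>
    have "v \<bullet> y t \<noteq> 0"
      using x(1) v(2) elim(2) by (simp add: y_def inner_add_right)
    then have "y t \<noteq> 0" by auto
    moreover have "y t \<bullet> w j \<noteq> 0" if "\<beta> j \<noteq> 0" for j
    proof (cases "w j \<in> l")
      case True
      then have "j \<in> On" using that by (simp add: On_def J_def)
      then show ?thesis using on von elim(2) by simp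
    next
      case False
      then show ?thesis using that elim(1) by (simp add: Off_def J_def)
    qed
    ultimately show ?case
      by (auto simp: horn_domain_def weight_form_of_real w_def vec_eq_iff)
  qed
  have "(\<Sum>j\<in>On. \<beta> j $ i) = 0" for i
  proof -
    \<comment> \<open>\<open>h\<close> is the \<open>i\<close>-th Horn coordinate along the curve, a
      real number there. \<open>G\<close> is what remains of it for nonzero \<open>t\<close> after
      the powers of \<open>t\<close> are extracted, and \<open>g\<close> is the limit of
      \<open>G\<close>.\<close>
    define h where "h t = (\<Prod>j\<in>J. (y t \<bullet> w j) powi (\<beta> j $ i))" for t
    define G where
      "G t = (\<Prod>j\<in>On. (v \<bullet> w j) powi (\<beta> j $ i)) * (\<Prod>j\<in>Off. (y t \<bullet> w j) powi (\<beta> j $ i))" for t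
    define g where
      "g = (\<Prod>j\<in>On. (v \<bullet> w j) powi (\<beta> j $ i)) * (\<Prod>j\<in>Off. (x \<bullet> w j) powi (\<beta> j $ i))"
    have "(G \<longlongrightarrow> g) (at 0)"
      unfolding G_def g_def
      by (intro tendsto_mult tendsto_const tendsto_prod tendsto_power_int lim x(2))
    moreover have "g \<noteq> 0"
      using x(2) von by (auto simp: g_def)
    moreover have h_eq: "of_real (h t) = horn_map \<beta> (\<chi> i. complex_of_real (y t $ i)) $ i" for t
      by (simp add: h_def horn_map_def J_def w_def weight_form_of_real)
    \<comment> \<open>An arbitrary admissible parameter; \<open>h t0\<close> is the nonzero constant
      compared with the limit.\<close>
    obtain t0 where t0: "(\<chi> i. complex_of_real (y t0 $ i)) \<in> horn_domain \<beta>"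
      using eventually_happens[OF ev_dom] by auto
    have "h t0 \<noteq> 0"
      using horn_map_in_torus[OF t0] h_eq[of t0] by (auto simp: torus_def)
    moreover have "\<forall>\<^sub>F t in at 0. t powi (\<Sum>j\<in>On. \<beta> j $ i) * G t = h t0"
      using ev_dom eventually_neq_at_within[of 0]
    proof eventually_elim
      case (elim t)
      have "complex_of_real (h t) = of_real (h t0)"
        using const[OF elim(1)] const[OF t0] by (simp only: h_eq)
      then have "h t = h t0" by simp
      have "J = On \<union> Off" "On \<inter> Off = {}" by (auto simp: On_def Off_def)
      then have "h t = (\<Prod>j\<in>On. (y t \<bullet> w j) powi (\<beta> j $ i)) * (\<Prod>j\<in>Off. (y t \<bullet> w j) powi (\<beta> j $ i))"
        unfolding h_def by (simp add: prod.union_disjoint)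
      also have "(\<Prod>j\<in>On. (y t \<bullet> w j) powi (\<beta> j $ i))
          = t powi (\<Sum>j\<in>On. \<beta> j $ i) * (\<Prod>j\<in>On. (v \<bullet> w j) powi (\<beta> j $ i))"
        by (simp add: on power_int_mult_distrib prod.distrib power_int_sum[OF elim(2)])
      finally show ?case using \<open>h t = h t0\<close> by (simp add: G_def mult.assoc)
    qed
    ultimately show ?thesis by (rule exponent_zero_if_eventually_const)
  qed
  then have "(\<Sum>j\<in>On. \<beta> j) = 0"
    by (simp add: vec_eq_iff)
  \<comment> \<open>Zero weights lie on every line and add nothing to the sum.\<close>
  also have "(\<Sum>j\<in>On. \<beta> j) = (\<Sum>j | real_weight (\<beta> j) \<in> l. \<beta> j)"
    by (rule sum.mono_neutral_left) (auto simp: On_def J_def w_def)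
  finally show "(\<Sum>j | real_weight (\<beta> j) \<in> l. \<beta> j) = 0" by simp
qed

theorem lemma3p1:
  fixes \<beta> :: "'n::finite \<Rightarrow> int ^ 'k::finite"
  assumes "surj (weight_map \<beta>)"
    and "inj (ray \<beta>)"
    and "calabi_yau \<beta>"
  shows "quasi_symmetric \<beta> \<longleftrightarrow> (\<exists>p. primary_discriminant \<beta> = {p})"
proof
  assume qs: "quasi_symmetric \<beta>"
  obtain \<mu> where \<mu>: "\<mu> \<in> horn_domain \<beta>"
    using horn_domain_nonempty by blast
  then have "horn_map \<beta> ` horn_domain \<beta> = {horn_map \<beta> \<mu>}"
    using horn_map_const_if_quasi_symmetric[OF qs] by blast
  then show "\<exists>p. primary_discriminant \<beta> = {p}"
    using zariski_closure_torus_singleton[OF horn_map_in_torus[OF \<mu>]]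
    by (auto simp: primary_discriminant_def)
next
  assume "\<exists>p. primary_discriminant \<beta> = {p}"
  then obtain p where "primary_discriminant \<beta> = {p}" by blast
  \<comment> \<open>The image lies in its closure, so a one-point closure makes the Horn map
    constant.\<close>
  moreover have "horn_map \<beta> ` horn_domain \<beta> \<subseteq> primary_discriminant \<beta>"
    unfolding primary_discriminant_def
    by (rule subset_zariski_closure_torus) (auto simp: horn_map_in_torus)
  ultimately show "quasi_symmetric \<beta>"
    by (intro quasi_symmetric_if_horn_map_const[of \<beta> p]) blast
qed

end
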